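(* Let $\Gamma\cup\{\varphi\}$ be a set of formulas over the signature $\Sigma=\{\land,\lor,\to,\neg,\sim,\square\}$. If $\Gamma\models_{IvFDE_T}\varphi$, then $\Gamma\vdash_{IvFDE_T}\varphi$.
   Context: Formulas are built from a countable set of propositional variables using binary $\land,\lor,\to$ and unary $\neg,\sim,\square$. Write $\alpha\leftrightarrow\beta$ for $(\alpha\to\beta)\land(\beta\to\alpha)$. Semantics. On $\{0,1\}$ let $\sqcap,\sqcup,\Rightarrow,\sim$ be the Boolean operations. Let $B_T=\{z\in\{0,1\}^4: z_2\le z_1,\ z_1\sqcap z_3=0,\ z_2\sqcap z_4=0,\ z_3\le z_4\}$ and let $D=\{z\in B_T:z_1=1\}$. The multioperations are: - $z\tilde\land w=\{u\in B_T: u_1=z_1\sqcap w_1,\ u_2=z_2\sqcap w_2,\ u_4=z_4\sqcup w_4,\ z_3\sqcup w_3\le u_3\le(z_2\Rightarrow w_3)\sqcap(w_2\Rightarrow z_3)\}$; - $z\tilde\lor w=\{u: u_1=z_1\sqcup w_1,\ u_3=z_3\sqcap w_3,\ u_4=z_4\sqcap w_4,\ z_2\sqcup w_2\le u_2\le(z_3\Rightarrow w_2)\sqcap(w_3\Rightarrow z_2)\}$; - $z\tilde\to w=\{u: u_1=z_1\Rightarrow w_1,\ u_3=z_2\sqcap w_3,\ u_4=z_1\sqcap w_4,\ z_3\sqcup w_2\le u_2\le(z_2\Rightarrow w_2)\sqcap(w_3\Rightarrow z_3)\}$; - $\tilde\sim z=\{u: u_1=\sim z_1,\ u_2=z_3,\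 u_3=z_2,\ z_2\le u_4\le\sim z_3\}$; - $\tilde\neg z=\{(z_4,z_3,z_2,z_1)\}$; - $\tilde\square z=\{u\in B_T:u_1=z_2\}$. A valuation is a map $v$ from formulas to $B_T$ with $v(\#(\varphi_1,\ldots,\varphi_n))\in\tilde\#(v(\varphi_1),\ldots,v(\varphi_n))$. We write $\Gamma\models_{IvFDE_T}\varphi$ iff every valuation designating (i.e., mapping into $D$) all of $\Gamma$ designates $\varphi$. Hilbert calculus $IvFDE_T$. The only rule is modus ponens. The axiom schemas are: - (Ax1) $\varphi\to(\psi\to\varphi)$; - (Ax2) $(\varphi\to(\psi\to\gamma))\to((\varphi\to\psi)\to(\varphi\to\gamma))$; - (Ax3) $\varphi\to(\psi\to(\varphi\land\psi))$; - (Ax4) $(\varphi\land\psi)\to\varphi$; - (Ax5) $(\varphi\land\psi)\to\psi$; - (Ax6) $\varphi\to(\varphi\lor\psi)$; - (Ax7) $\psi\to(\varphi\lor\psi)$; - (Ax8) $(\varphi\to\gamma)\to((\psi\to\gamma)\to((\varphi\lor\psi)\to\gamma))$; - $\neg\neg\varphi\leftrightarrow\varphi$; - $\neg(\varphi\lor\psi)\leftrightarrow(\neg\varphi\land\neg\psi)$; - $\neg(\varphi\land\psi)\leftrightarrow(\neg\varphi\lor\neg\psi)$; - $\neg(\varphi\to\psi)\leftrightarrow(\varphi\land\neg\psi)$; - $\varphi\lor(\varphi\to\psi)$; - $(\sim\psi\to\sim\varphi)\to((\sim\psi\to\varphi)\to\psi)$; - (K) $\square(\varphi\to\psi)\to(\square\varphi\to\square\psi)$;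 - (K1) $\square(\varphi\to\psi)\to(\square\sim\psi\to\square\sim\varphi)$; - (K2) $\square\sim(\varphi\to\psi)\leftrightarrow(\square\varphi\land\square\sim\psi)$; - (M1) $(\square\sim\varphi\lor\square\psi)\to\square(\varphi\to\psi)$; - (T) $\square\varphi\to\varphi$; - (DN1) $\square\varphi\leftrightarrow\square\sim\sim\varphi$; - (N1) $\square(\varphi\land\psi)\leftrightarrow(\square\varphi\land\square\psi)$; - (N2) $\square\sim(\varphi\lor\psi)\leftrightarrow\square(\sim\varphi\land\sim\psi)$; - (N3) $(\square\sim\varphi\lor\square\sim\psi)\to\square\sim(\varphi\land\psi)$; - (N4) $(\square\varphi\lor\square\psi)\to\square(\varphi\lor\psi)$; - (N5) $\square\varphi\leftrightarrow\square\sim\neg\varphi$; - (N6) $\square\sim\varphi\leftrightarrow\square\sim\neg\neg\varphi$; - (N7) $\square\sim(\varphi\land\psi)\to(\square\varphi\to\square\sim\psi)$; - (N8) $\square\sim(\varphi\land\psi)\to(\square\psi\to\square\sim\varphi)$; - (N9) $\square(\varphi\lor\psi)\to(\square\sim\varphi\to\square\psi)$; - (N10) $\square(\varphi\lor\psi)\to(\square\sim\psi\to\square\varphi)$. $\vdash_{IvFDE_T}$ is derivability in this calculus. *)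

theory Defs
  imports "HOL-Library.Countable"
begin

datatype 'v fm =
    Var 'v
  | Conj "'v fm" "'v fm"  (infixr "\<^bold>\<and>" 75)
  | Disj "'v fm" "'v fm"  (infixr "\<^bold>\<or>" 70)
  | Impl "'v fm" "'v fm"  (infixr "\<^bold>\<rightarrow>" 65)
  | Neg "'v fm"  ("\<^bold>\<not> _" [80] 80)
  | Sim "'v fm"  ("\<^bold>\<sim> _" [80] 80)
  | Box "'v fm"  ("\<^bold>\<box> _" [80] 80)

abbreviation Equiv :: "'v fm \<Rightarrow> 'v fm \<Rightarrow> 'v fm"  (infix "\<^bold>\<leftrightarrow>" 60) where
  "\<alpha> \<^bold>\<leftrightarrow> \<beta> \<equiv> (\<alpha> \<^bold>\<rightarrow> \<beta>) \<^bold>\<and> (\<beta> \<^bold>\<rightarrow> \<alpha>)"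

text \<open>
  The two-element Boolean algebra is \<open>bool\<close>, with \<open>False \<le> True\<close>. A snapshot is a
  quadruple; a valuation \<open>v\<close> puts at \<open>v \<phi>\<close> the values of \<open>\<phi>\<close>, \<open>\<^bold>\<box> \<phi>\<close>,
  \<open>\<^bold>\<box> \<^bold>\<sim> \<phi>\<close> and \<open>\<^bold>\<not> \<phi>\<close>, in this order.
\<close>

type_synonym snapshot = "bool \<times> bool \<times> bool \<times> bool"

definition B_T :: "snapshot set" where
  "B_T = {(z1, z2, z3, z4).
     z2 \<le> z1 \<and> (z1 \<and> z3) = False \<and> (z2 \<and> z4) = False \<and> z3 \<le> z4}"

definition D :: "snapshot set" where
  "D = {(z1, z2, z3, z4). (z1, z2, z3, z4) \<in> B_T \<and> z1 = True}"

text \<open>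
  The multioperations take values in sets of elements of \<open>B_T\<close>; only their restriction
  to arguments in \<open>B_T\<close> matters.
\<close>

fun mconj :: "snapshot \<Rightarrow> snapshot \<Rightarrow> snapshot set" where
  "mconj (z1, z2, z3, z4) (w1, w2, w3, w4) = {(u1, u2, u3, u4).
     (u1, u2, u3, u4) \<in> B_T \<and>
     u1 = (z1 \<and> w1) \<and> u2 = (z2 \<and> w2) \<and> u4 = (z4 \<or> w4) \<and>
     (z3 \<or> w3) \<le> u3 \<and> u3 \<le> ((z2 \<longrightarrow> w3) \<and> (w2 \<longrightarrow> z3))}"

fun mdisj :: "snapshot \<Rightarrow> snapshot \<Rightarrow> snapshot set" where
  "mdisj (z1, z2, z3, z4) (w1, w2, w3, w4) = {(u1, u2, u3, u4).
     (u1, u2, u3, u4) \<in> B_T \<and>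
     u1 = (z1 \<or> w1) \<and> u3 = (z3 \<and> w3) \<and> u4 = (z4 \<and> w4) \<and>
     (z2 \<or> w2) \<le> u2 \<and> u2 \<le> ((z3 \<longrightarrow> w2) \<and> (w3 \<longrightarrow> z2))}"

fun mimpl :: "snapshot \<Rightarrow> snapshot \<Rightarrow> snapshot set" where
  "mimpl (z1, z2, z3, z4) (w1, w2, w3, w4) = {(u1, u2, u3, u4).
     (u1, u2, u3, u4) \<in> B_T \<and>
     u1 = (z1 \<longrightarrow> w1) \<and> u3 = (z2 \<and> w3) \<and> u4 = (z1 \<and> w4) \<and>
     (z3 \<or> w2) \<le> u2 \<and> u2 \<le> ((z2 \<longrightarrow> w2) \<and> (w3 \<longrightarrow> z3))}"

fun msim :: "snapshot \<Rightarrow> snapshot set" where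
  "msim (z1, z2, z3, z4) = {(u1, u2, u3, u4).
     (u1, u2, u3, u4) \<in> B_T \<and>
     u1 = (\<not> z1) \<and> u2 = z3 \<and> u3 = z2 \<and> z2 \<le> u4 \<and> u4 \<le> (\<not> z3)}"

fun mneg :: "snapshot \<Rightarrow> snapshot set" where
  "mneg (z1, z2, z3, z4) = {(z4, z3, z2, z1)}"

fun mbox :: "snapshot \<Rightarrow> snapshot set" where
  "mbox (z1, z2, z3, z4) = {(u1, u2, u3, u4). (u1, u2, u3, u4) \<in> B_T \<and> u1 = z2}"

definition valuation :: "('v fm \<Rightarrow> snapshot) \<Rightarrow> bool" where
  "valuation v \<longleftrightarrow>
     (\<forall>\<phi>. v \<phi> \<in> B_T) \<and>
     (\<forall>\<phi> \<psi>. v (\<phi> \<^bold>\<and> \<psi>) \<in> mconj (v \<phi>) (v \<psi>)) \<and>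
     (\<forall>\<phi> \<psi>. v (\<phi> \<^bold>\<or> \<psi>) \<in> mdisj (v \<phi>) (v \<psi>)) \<and>
     (\<forall>\<phi> \<psi>. v (\<phi> \<^bold>\<rightarrow> \<psi>) \<in> mimpl (v \<phi>) (v \<psi>)) \<and>
     (\<forall>\<phi>. v (\<^bold>\<not> \<phi>) \<in> mneg (v \<phi>)) \<and>
     (\<forall>\<phi>. v (\<^bold>\<sim> \<phi>) \<in> msim (v \<phi>)) \<and>
     (\<forall>\<phi>. v (\<^bold>\<box> \<phi>) \<in> mbox (v \<phi>))"

definition entails :: "'v fm set \<Rightarrow> 'v fm \<Rightarrow> bool"  (infix "\<Turnstile>\<^sub>I\<^sub>v\<^sub>F\<^sub>D\<^sub>E\<^sub>T" 50) where
  "\<Gamma> \<Turnstile>\<^sub>I\<^sub>v\<^sub>F\<^sub>D\<^sub>E\<^sub>T \<phi> \<longleftrightarrow>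
     (\<forall>v. valuation v \<longrightarrow> (\<forall>\<psi>\<in>\<Gamma>. v \<psi> \<in> D) \<longrightarrow> v \<phi> \<in> D)"

inductive axiom :: "'v fm \<Rightarrow> bool" where
  Ax1: "axiom (\<phi> \<^bold>\<rightarrow> (\<psi> \<^bold>\<rightarrow> \<phi>))"
| Ax2: "axiom ((\<phi> \<^bold>\<rightarrow> (\<psi> \<^bold>\<rightarrow> \<gamma>)) \<^bold>\<rightarrow> ((\<phi> \<^bold>\<rightarrow> \<psi>) \<^bold>\<rightarrow> (\<phi> \<^bold>\<rightarrow> \<gamma>)))"
| Ax3: "axiom (\<phi> \<^bold>\<rightarrow> (\<psi> \<^bold>\<rightarrow> (\<phi> \<^bold>\<and> \<psi>)))"
| Ax4: "axiom ((\<phi> \<^bold>\<and> \<psi>) \<^bold>\<rightarrow> \<phi>)"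
| Ax5: "axiom ((\<phi> \<^bold>\<and> \<psi>) \<^bold>\<rightarrow> \<psi>)"
| Ax6: "axiom (\<phi> \<^bold>\<rightarrow> (\<phi> \<^bold>\<or> \<psi>))"
| Ax7: "axiom (\<psi> \<^bold>\<rightarrow> (\<phi> \<^bold>\<or> \<psi>))"
| Ax8: "axiom ((\<phi> \<^bold>\<rightarrow> \<gamma>) \<^bold>\<rightarrow> ((\<psi> \<^bold>\<rightarrow> \<gamma>) \<^bold>\<rightarrow> ((\<phi> \<^bold>\<or> \<psi>) \<^bold>\<rightarrow> \<gamma>)))"
| NegNeg: "axiom (\<^bold>\<not> \<^bold>\<not> \<phi> \<^bold>\<leftrightarrow> \<phi>)"
| NegDisj: "axiom (\<^bold>\<not> (\<phi> \<^bold>\<or> \<psi>) \<^bold>\<leftrightarrow> (\<^bold>\<not> \<phi> \<^bold>\<and> \<^bold>\<not> \<psi>))"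
| NegConj: "axiom (\<^bold>\<not> (\<phi> \<^bold>\<and> \<psi>) \<^bold>\<leftrightarrow> (\<^bold>\<not> \<phi> \<^bold>\<or> \<^bold>\<not> \<psi>))"
| NegImpl: "axiom (\<^bold>\<not> (\<phi> \<^bold>\<rightarrow> \<psi>) \<^bold>\<leftrightarrow> (\<phi> \<^bold>\<and> \<^bold>\<not> \<psi>))"
| DisjImpl: "axiom (\<phi> \<^bold>\<or> (\<phi> \<^bold>\<rightarrow> \<psi>))"
| SimContra: "axiom ((\<^bold>\<sim> \<psi> \<^bold>\<rightarrow> \<^bold>\<sim> \<phi>) \<^bold>\<rightarrow> ((\<^bold>\<sim> \<psi> \<^bold>\<rightarrow> \<phi>) \<^bold>\<rightarrow> \<psi>))"
| K: "axiom (\<^bold>\<box> (\<phi> \<^bold>\<rightarrow> \<psi>) \<^bold>\<rightarrow> (\<^bold>\<box> \<phi> \<^bold>\<rightarrow> \<^bold>\<box> \<psi>))"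
| K1: "axiom (\<^bold>\<box> (\<phi> \<^bold>\<rightarrow> \<psi>) \<^bold>\<rightarrow> (\<^bold>\<box> \<^bold>\<sim> \<psi> \<^bold>\<rightarrow> \<^bold>\<box> \<^bold>\<sim> \<phi>))"
| K2: "axiom (\<^bold>\<box> \<^bold>\<sim> (\<phi> \<^bold>\<rightarrow> \<psi>) \<^bold>\<leftrightarrow> (\<^bold>\<box> \<phi> \<^bold>\<and> \<^bold>\<box> \<^bold>\<sim> \<psi>))"
| M1: "axiom ((\<^bold>\<box> \<^bold>\<sim> \<phi> \<^bold>\<or> \<^bold>\<box> \<psi>) \<^bold>\<rightarrow> \<^bold>\<box> (\<phi> \<^bold>\<rightarrow> \<psi>))"
| T: "axiom (\<^bold>\<box> \<phi> \<^bold>\<rightarrow> \<phi>)"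
| DN1: "axiom (\<^bold>\<box> \<phi> \<^bold>\<leftrightarrow> \<^bold>\<box> \<^bold>\<sim> \<^bold>\<sim> \<phi>)"
| N1: "axiom (\<^bold>\<box> (\<phi> \<^bold>\<and> \<psi>) \<^bold>\<leftrightarrow> (\<^bold>\<box> \<phi> \<^bold>\<and> \<^bold>\<box> \<psi>))"
| N2: "axiom (\<^bold>\<box> \<^bold>\<sim> (\<phi> \<^bold>\<or> \<psi>) \<^bold>\<leftrightarrow> \<^bold>\<box> (\<^bold>\<sim> \<phi> \<^bold>\<and> \<^bold>\<sim> \<psi>))"
| N3: "axiom ((\<^bold>\<box> \<^bold>\<sim> \<phi> \<^bold>\<or> \<^bold>\<box> \<^bold>\<sim> \<psi>) \<^bold>\<rightarrow> \<^bold>\<box> \<^bold>\<sim> (\<phi> \<^bold>\<and> \<psi>))"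
| N4: "axiom ((\<^bold>\<box> \<phi> \<^bold>\<or> \<^bold>\<box> \<psi>) \<^bold>\<rightarrow> \<^bold>\<box> (\<phi> \<^bold>\<or> \<psi>))"
| N5: "axiom (\<^bold>\<box> \<phi> \<^bold>\<leftrightarrow> \<^bold>\<box> \<^bold>\<sim> \<^bold>\<not> \<phi>)"
| N6: "axiom (\<^bold>\<box> \<^bold>\<sim> \<phi> \<^bold>\<leftrightarrow> \<^bold>\<box> \<^bold>\<sim> \<^bold>\<not> \<^bold>\<not> \<phi>)"
| N7: "axiom (\<^bold>\<box> \<^bold>\<sim> (\<phi> \<^bold>\<and> \<psi>) \<^bold>\<rightarrow> (\<^bold>\<box> \<phi> \<^bold>\<rightarrow> \<^bold>\<box> \<^bold>\<sim> \<psi>))"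
| N8: "axiom (\<^bold>\<box> \<^bold>\<sim> (\<phi> \<^bold>\<and> \<psi>) \<^bold>\<rightarrow> (\<^bold>\<box> \<psi> \<^bold>\<rightarrow> \<^bold>\<box> \<^bold>\<sim> \<phi>))"
| N9: "axiom (\<^bold>\<box> (\<phi> \<^bold>\<or> \<psi>) \<^bold>\<rightarrow> (\<^bold>\<box> \<^bold>\<sim> \<phi> \<^bold>\<rightarrow> \<^bold>\<box> \<psi>))"
| N10: "axiom (\<^bold>\<box> (\<phi> \<^bold>\<or> \<psi>) \<^bold>\<rightarrow> (\<^bold>\<box> \<^bold>\<sim> \<psi> \<^bold>\<rightarrow> \<^bold>\<box> \<phi>))"

inductive derivable :: "'v fm set \<Rightarrow> 'v fm \<Rightarrow> bool"  (infix "\<turnstile>\<^sub>I\<^sub>v\<^sub>F\<^sub>D\<^sub>E\<^sub>T" 50)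
  for \<Gamma> :: "'v fm set" where
  Prem: "\<phi> \<in> \<Gamma> \<Longrightarrow> \<Gamma> \<turnstile>\<^sub>I\<^sub>v\<^sub>F\<^sub>D\<^sub>E\<^sub>T \<phi>"
| Ax: "axiom \<phi> \<Longrightarrow> \<Gamma> \<turnstile>\<^sub>I\<^sub>v\<^sub>F\<^sub>D\<^sub>E\<^sub>T \<phi>"
| MP: "\<Gamma> \<turnstile>\<^sub>I\<^sub>v\<^sub>F\<^sub>D\<^sub>E\<^sub>T \<phi> \<Longrightarrow> \<Gamma> \<turnstile>\<^sub>I\<^sub>v\<^sub>F\<^sub>D\<^sub>E\<^sub>T \<phi> \<^bold>\<rightarrow> \<psi> \<Longrightarrow> \<Gamma> \<turnstile>\<^sub>I\<^sub>v\<^sub>F\<^sub>D\<^sub>E\<^sub>T \<psi>"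

end

(* Extend Gamma, by Zorn's lemma, to a set Delta that is maximal among the sets not deriving phi.
   Such a Delta is deductively closed and behaves classically on conjunction, disjunction,
   implication and Sim. Reading off at each formula A the membership in Delta of A, Box A,
   Box Sim A and Neg A gives a valuation that designates exactly the elements of Delta: each
   condition in the multioperations is the counterpart of one or two modal axioms. *)
theory Submission imports Defs begin

lemma derivable_mono: "\<Gamma> \<turnstile>\<^sub>I\<^sub>v\<^sub>F\<^sub>D\<^sub>E\<^sub>T \<phi> \<Longrightarrow> \<Gamma> \<subseteq> \<Delta> \<Longrightarrow> \<Delta> \<turnstile>\<^sub>I\<^sub>v\<^sub>F\<^sub>D\<^sub>E\<^sub>T \<phi>"
  by (induction rule: derivable.induct) (auto intro: derivable.intros)

lemma derivable_MP2:
  assumes "\<Gamma> \<turnstile>\<^sub>I\<^sub>v\<^sub>F\<^sub>D\<^sub>E\<^sub>T \<alpha> \<^bold>\<rightarrow> \<beta> \<^bold>\<rightarrow> \<gamma>" and "\<Gamma> \<turnstile>\<^sub>I\<^sub>v\<^sub>F\<^sub>D\<^sub>E\<^sub>T \<alpha>" and "\<Gamma> \<turnstile>\<^sub>I\<^sub>v\<^sub>F\<^sub>D\<^sub>E\<^sub>T \<beta>"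
  shows "\<Gamma> \<turnstile>\<^sub>I\<^sub>v\<^sub>F\<^sub>D\<^sub>E\<^sub>T \<gamma>"
  using assms MP by blast

lemma derivable_weaken: "\<Gamma> \<turnstile>\<^sub>I\<^sub>v\<^sub>F\<^sub>D\<^sub>E\<^sub>T \<beta> \<Longrightarrow> \<Gamma> \<turnstile>\<^sub>I\<^sub>v\<^sub>F\<^sub>D\<^sub>E\<^sub>T \<alpha> \<^bold>\<rightarrow> \<beta>"
  using Ax[OF Ax1] MP by blast

lemma derivable_refl: "\<Gamma> \<turnstile>\<^sub>I\<^sub>v\<^sub>F\<^sub>D\<^sub>E\<^sub>T \<alpha> \<^bold>\<rightarrow> \<alpha>"
  \<comment> \<open>This is the combinator identity I = S K K, with \<open>Ax2\<close> as S and
    \<open>Ax1\<close> as K.\<close>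
  using derivable_MP2[OF Ax[OF Ax2] Ax[OF Ax1] Ax[OF Ax1]] .

text \<open>Modus ponens is the only rule, with no necessitation, so \<open>Ax1\<close> and
  \<open>Ax2\<close> carry the usual induction even with modal axioms around.\<close>

lemma deduction_theorem: "insert \<alpha> \<Gamma> \<turnstile>\<^sub>I\<^sub>v\<^sub>F\<^sub>D\<^sub>E\<^sub>T \<beta> \<Longrightarrow> \<Gamma> \<turnstile>\<^sub>I\<^sub>v\<^sub>F\<^sub>D\<^sub>E\<^sub>T \<alpha> \<^bold>\<rightarrow> \<beta>"
proof (induction rule: derivable.induct)
  case (Prem \<beta>)
  then show ?case
    using derivable_refl derivable_weaken derivable.Prem by blast
next
  case (Ax \<beta>)
  then show ?case
    using derivable_weaken derivable.Ax by blast
next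
  case (MP \<beta> \<gamma>)
  show ?case
    using derivable_MP2[OF derivable.Ax[OF Ax2] MP.IH(2,1)] .
qed

text \<open>Compactness along chains: the two premises of \<open>MP\<close> come from comparable
  members, and the larger one derives both. An axiom still needs some member to be derived from,
  hence nonemptiness.\<close>

lemma derivable_Union_chain:
  assumes "\<Union>\<C> \<turnstile>\<^sub>I\<^sub>v\<^sub>F\<^sub>D\<^sub>E\<^sub>T \<phi>" and "subset.chain \<A> \<C>" and "\<C> \<noteq> {}"
  shows "\<exists>\<Gamma>\<in>\<C>. \<Gamma> \<turnstile>\<^sub>I\<^sub>v\<^sub>F\<^sub>D\<^sub>E\<^sub>T \<phi>"
  using assms(1)
proof (induction rule: derivable.induct)
  case (Prem \<phi>)
  then show ?case using derivable.Prem by blast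
next
  case (Ax \<phi>)
  then show ?case using derivable.Ax assms(3) by blast
next
  case (MP \<phi> \<psi>)
  then obtain \<Gamma> \<Delta> where "\<Gamma> \<in> \<C>" "\<Delta> \<in> \<C>"
    and d: "\<Gamma> \<turnstile>\<^sub>I\<^sub>v\<^sub>F\<^sub>D\<^sub>E\<^sub>T \<phi>" "\<Delta> \<turnstile>\<^sub>I\<^sub>v\<^sub>F\<^sub>D\<^sub>E\<^sub>T \<phi> \<^bold>\<rightarrow> \<psi>"
    by blast
  moreover have "\<Gamma> \<subseteq> \<Delta> \<or> \<Delta> \<subseteq> \<Gamma>"
    using assms(2) \<open>\<Gamma> \<in> \<C>\<close> \<open>\<Delta> \<in> \<C>\<close> by (auto simp: subset.chain_def)
  ultimately show ?case
    using derivable_mono derivable.MP by metis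
qed

text \<open>Maximality is tested on one-formula extensions only. By \<open>derivable_mono\<close>
  this amounts to maximality under inclusion, and it is the form to which the deduction theorem
  applies.\<close>

definition maximal_non_deriving :: "'v fm \<Rightarrow> 'v fm set \<Rightarrow> bool" where
  "maximal_non_deriving \<phi> \<Delta> \<longleftrightarrow>
     \<not> \<Delta> \<turnstile>\<^sub>I\<^sub>v\<^sub>F\<^sub>D\<^sub>E\<^sub>T \<phi> \<and> (\<forall>\<psi>. \<psi> \<notin> \<Delta> \<longrightarrow> insert \<psi> \<Delta> \<turnstile>\<^sub>I\<^sub>v\<^sub>F\<^sub>D\<^sub>E\<^sub>T \<phi>)"

lemma lindenbaum:
  assumes "\<not> \<Gamma> \<turnstile>\<^sub>I\<^sub>v\<^sub>F\<^sub>D\<^sub>E\<^sub>T \<phi>"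
  obtains \<Delta> where "\<Gamma> \<subseteq> \<Delta>" and "maximal_non_deriving \<phi> \<Delta>"
proof -
  define \<A> where "\<A> = {\<Delta>. \<Gamma> \<subseteq> \<Delta> \<and> \<not> \<Delta> \<turnstile>\<^sub>I\<^sub>v\<^sub>F\<^sub>D\<^sub>E\<^sub>T \<phi>}"
  have "\<exists>M\<in>\<A>. \<forall>X\<in>\<A>. M \<subseteq> X \<longrightarrow> X = M"
  proof (rule subset_Zorn_nonempty)
    show "\<A> \<noteq> {}"
      using assms by (auto simp: \<A>_def)
    show "\<Union>\<C> \<in> \<A>" if "\<C> \<noteq> {}" and "subset.chain \<A> \<C>" for \<C>
    proof -
      have "\<C> \<subseteq> \<A>"
        using that(2) by (simp add: subset.chain_def)
      \<comment> \<open>The chain is nonempty, so its union lies above \<Gamma>; a derivation from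
        the union would already exist in some member.\<close>
      then show ?thesis
        using derivable_Union_chain[OF _ that(2,1)] that(1) by (fastforce simp: \<A>_def)
    qed
  qed
  then obtain \<Delta> where \<Delta>: "\<Delta> \<in> \<A>" and max: "\<And>X. X \<in> \<A> \<Longrightarrow> \<Delta> \<subseteq> X \<Longrightarrow> X = \<Delta>"
    by blast
  have "insert \<psi> \<Delta> \<turnstile>\<^sub>I\<^sub>v\<^sub>F\<^sub>D\<^sub>E\<^sub>T \<phi>" if "\<psi> \<notin> \<Delta>" for \<psi>
    using max[of "insert \<psi> \<Delta>"] \<Delta> that by (auto simp: \<A>_def)
  with \<Delta> that show thesis
    by (auto simp: \<A>_def maximal_non_deriving_def)
qed

context
  fixes \<phi> :: "'v fm" and \<Delta> :: "'v fm set"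
  assumes maximal: "maximal_non_deriving \<phi> \<Delta>"
begin

lemma derivable_imp_mem:
  assumes "\<Delta> \<turnstile>\<^sub>I\<^sub>v\<^sub>F\<^sub>D\<^sub>E\<^sub>T \<psi>" shows "\<psi> \<in> \<Delta>"
  using maximal assms MP deduction_theorem unfolding maximal_non_deriving_def by blast

lemma axiom_mem: "axiom \<psi> \<Longrightarrow> \<psi> \<in> \<Delta>"
  by (simp add: Ax derivable_imp_mem)

lemma mem_MP: "\<alpha> \<^bold>\<rightarrow> \<beta> \<in> \<Delta> \<Longrightarrow> \<alpha> \<in> \<Delta> \<Longrightarrow> \<beta> \<in> \<Delta>"
  by (meson MP Prem derivable_imp_mem)

lemma axiom_MP: "axiom (\<alpha> \<^bold>\<rightarrow> \<beta>) \<Longrightarrow> \<alpha> \<in> \<Delta> \<Longrightarrow> \<beta> \<in> \<Delta>"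
  using axiom_mem mem_MP by blast

lemma axiom_MP2: "axiom (\<alpha> \<^bold>\<rightarrow> \<beta> \<^bold>\<rightarrow> \<gamma>) \<Longrightarrow> \<alpha> \<in> \<Delta> \<Longrightarrow> \<beta> \<in> \<Delta> \<Longrightarrow> \<gamma> \<in> \<Delta>"
  using axiom_MP mem_MP by blast

lemma Conj_mem_iff: "\<alpha> \<^bold>\<and> \<beta> \<in> \<Delta> \<longleftrightarrow> \<alpha> \<in> \<Delta> \<and> \<beta> \<in> \<Delta>"
  using axiom_MP[OF Ax4] axiom_MP[OF Ax5] axiom_MP2[OF Ax3] by blast

lemma axiom_Equiv: "axiom (\<alpha> \<^bold>\<leftrightarrow> \<beta>) \<Longrightarrow> \<alpha> \<in> \<Delta> \<longleftrightarrow> \<beta> \<in> \<Delta>"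
  using axiom_mem mem_MP Conj_mem_iff by blast

lemma goal_not_mem: "\<phi> \<notin> \<Delta>"
  using maximal Prem unfolding maximal_non_deriving_def by blast

text \<open>The goal acts as falsum: implying it serves as a negation for formulas outside
  \<Delta>.\<close>

lemma not_mem_imp_Impl_goal_mem: "\<alpha> \<notin> \<Delta> \<Longrightarrow> \<alpha> \<^bold>\<rightarrow> \<phi> \<in> \<Delta>"
  using maximal deduction_theorem derivable_imp_mem unfolding maximal_non_deriving_def by blast

text \<open>Primeness: if both disjuncts were missing, both would imply the goal, and
  \<open>Ax8\<close> would put the goal into \<Delta>.\<close>

lemma Disj_mem_iff: "\<alpha> \<^bold>\<or> \<beta> \<in> \<Delta> \<longleftrightarrow> \<alpha> \<in> \<Delta> \<or> \<beta> \<in> \<Delta>"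
  using axiom_MP[OF Ax6] axiom_MP[OF Ax7] axiom_MP2[OF Ax8, THEN mem_MP]
    not_mem_imp_Impl_goal_mem goal_not_mem by blast

text \<open>\<open>DisjImpl\<close> and primeness supply the classical case in which the antecedent
  is missing.\<close>

lemma Impl_mem_iff: "\<alpha> \<^bold>\<rightarrow> \<beta> \<in> \<Delta> \<longleftrightarrow> (\<alpha> \<in> \<Delta> \<longrightarrow> \<beta> \<in> \<Delta>)"
  using axiom_mem[OF DisjImpl] Disj_mem_iff mem_MP axiom_MP[OF Ax1] by blast

lemma Sim_mem_iff: "\<^bold>\<sim> \<alpha> \<in> \<Delta> \<longleftrightarrow> \<alpha> \<notin> \<Delta>"
  \<comment> \<open>The first instance concludes the goal, so \<alpha> and its \<open>Sim\<close>
    cannot both be members. The second has only \<alpha> as parameter and forces \<alpha> into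
    \<Delta> when its \<open>Sim\<close> is missing.\<close>
  using axiom_mem[OF SimContra[of \<phi> \<alpha>]] axiom_mem[OF SimContra[of \<alpha> \<alpha>]] goal_not_mem
  by (auto simp: Impl_mem_iff)

lemma Box_imp_mem: "\<^bold>\<box> \<alpha> \<in> \<Delta> \<Longrightarrow> \<alpha> \<in> \<Delta>"
  using axiom_MP[OF T] .

lemma Box_Sim_Neg_iff: "\<^bold>\<box> \<^bold>\<sim> \<^bold>\<not> \<alpha> \<in> \<Delta> \<longleftrightarrow> \<^bold>\<box> \<alpha> \<in> \<Delta>"
  using axiom_Equiv[OF N5] by blast

text \<open>Apply \<open>N5\<close> to the formula \<open>Neg\<close> \<alpha>, then remove the
  double \<open>Neg\<close> under \<open>Sim\<close> by \<open>N6\<close>.\<close>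

lemma Box_Neg_iff: "\<^bold>\<box> \<^bold>\<not> \<alpha> \<in> \<Delta> \<longleftrightarrow> \<^bold>\<box> \<^bold>\<sim> \<alpha> \<in> \<Delta>"
  using axiom_Equiv[OF N6] Box_Sim_Neg_iff by blast

text \<open>\<open>N5\<close> followed by \<open>T\<close> gives \<open>Sim\<close> of
  \<open>Neg\<close> \<alpha>, which excludes \<open>Neg\<close> \<alpha>. This is the condition of
  \<open>B_T\<close> on the second and fourth coordinates.\<close>

lemma Box_imp_Neg_not_mem: "\<^bold>\<box> \<alpha> \<in> \<Delta> \<Longrightarrow> \<^bold>\<not> \<alpha> \<notin> \<Delta>"
  using Box_Sim_Neg_iff Box_imp_mem Sim_mem_iff by blast

lemma Box_Sim_imp_Neg_mem: "\<^bold>\<box> \<^bold>\<sim> \<alpha> \<in> \<Delta> \<Longrightarrow> \<^bold>\<not> \<alpha> \<in> \<Delta>"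
  using Box_Neg_iff Box_imp_mem by blast

lemma Box_Sim_Sim_iff: "\<^bold>\<box> \<^bold>\<sim> \<^bold>\<sim> \<alpha> \<in> \<Delta> \<longleftrightarrow> \<^bold>\<box> \<alpha> \<in> \<Delta>"
  using axiom_Equiv[OF DN1] by blast

definition canonical :: "'v fm \<Rightarrow> snapshot" where
  "canonical \<psi> = (\<psi> \<in> \<Delta>, \<^bold>\<box> \<psi> \<in> \<Delta>, \<^bold>\<box> \<^bold>\<sim> \<psi> \<in> \<Delta>, \<^bold>\<not> \<psi> \<in> \<Delta>)"

lemma canonical_in_B_T: "canonical \<psi> \<in> B_T"
  using Box_imp_mem[of \<psi>] Box_imp_mem[of "\<^bold>\<sim> \<psi>"] Box_imp_Neg_not_mem[of \<psi>]
    Box_Sim_imp_Neg_mem[of \<psi>]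
  by (auto simp: canonical_def B_T_def Sim_mem_iff)

lemma Box_Conj_iff: "\<^bold>\<box> (\<alpha> \<^bold>\<and> \<beta>) \<in> \<Delta> \<longleftrightarrow> \<^bold>\<box> \<alpha> \<in> \<Delta> \<and> \<^bold>\<box> \<beta> \<in> \<Delta>"
  using axiom_Equiv[OF N1] Conj_mem_iff by simp

text \<open>\<open>N2\<close> replaces the disjunction under \<open>Sim\<close> by a conjunction,
  over which \<open>Box\<close> distributes.\<close>

lemma Box_Sim_Disj_iff: "\<^bold>\<box> \<^bold>\<sim> (\<alpha> \<^bold>\<or> \<beta>) \<in> \<Delta> \<longleftrightarrow> \<^bold>\<box> \<^bold>\<sim> \<alpha> \<in> \<Delta> \<and> \<^bold>\<box> \<^bold>\<sim> \<beta> \<in> \<Delta>"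
  using axiom_Equiv[OF N2] Box_Conj_iff by simp

lemma Box_Sim_Impl_iff: "\<^bold>\<box> \<^bold>\<sim> (\<alpha> \<^bold>\<rightarrow> \<beta>) \<in> \<Delta> \<longleftrightarrow> \<^bold>\<box> \<alpha> \<in> \<Delta> \<and> \<^bold>\<box> \<^bold>\<sim> \<beta> \<in> \<Delta>"
  using axiom_Equiv[OF K2] Conj_mem_iff by simp

lemma Neg_Conj_iff: "\<^bold>\<not> (\<alpha> \<^bold>\<and> \<beta>) \<in> \<Delta> \<longleftrightarrow> \<^bold>\<not> \<alpha> \<in> \<Delta> \<or> \<^bold>\<not> \<beta> \<in> \<Delta>"
  using axiom_Equiv[OF NegConj] Disj_mem_iff by simp

lemma Neg_Disj_iff: "\<^bold>\<not> (\<alpha> \<^bold>\<or> \<beta>) \<in> \<Delta> \<longleftrightarrow> \<^bold>\<not> \<alpha> \<in> \<Delta> \<and> \<^bold>\<not> \<beta> \<in> \<Delta>"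
  using axiom_Equiv[OF NegDisj] Conj_mem_iff by simp

lemma Neg_Impl_iff: "\<^bold>\<not> (\<alpha> \<^bold>\<rightarrow> \<beta>) \<in> \<Delta> \<longleftrightarrow> \<alpha> \<in> \<Delta> \<and> \<^bold>\<not> \<beta> \<in> \<Delta>"
  using axiom_Equiv[OF NegImpl] Conj_mem_iff by simp

lemma canonical_Conj: "canonical (\<alpha> \<^bold>\<and> \<beta>) \<in> mconj (canonical \<alpha>) (canonical \<beta>)"
proof -
  \<comment> \<open>Only the third coordinate is not fixed by the arguments: \<open>N3\<close> is
    its lower bound, \<open>N7\<close> and \<open>N8\<close> are the two halves of its upper
    bound.\<close>
  have "\<^bold>\<box> \<^bold>\<sim> \<alpha> \<in> \<Delta> \<or> \<^bold>\<box> \<^bold>\<sim> \<beta> \<in> \<Delta> \<Longrightarrow> \<^bold>\<box> \<^bold>\<sim> (\<alpha> \<^bold>\<and> \<beta>) \<in> \<Delta>"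
    using axiom_MP[OF N3] Disj_mem_iff by blast
  moreover have "\<^bold>\<box> \<^bold>\<sim> (\<alpha> \<^bold>\<and> \<beta>) \<in> \<Delta> \<Longrightarrow> \<^bold>\<box> \<alpha> \<in> \<Delta> \<Longrightarrow> \<^bold>\<box> \<^bold>\<sim> \<beta> \<in> \<Delta>"
    by (rule axiom_MP2[OF N7])
  moreover have "\<^bold>\<box> \<^bold>\<sim> (\<alpha> \<^bold>\<and> \<beta>) \<in> \<Delta> \<Longrightarrow> \<^bold>\<box> \<beta> \<in> \<Delta> \<Longrightarrow> \<^bold>\<box> \<^bold>\<sim> \<alpha> \<in> \<Delta>"
    by (rule axiom_MP2[OF N8])
  ultimately show ?thesis
    using canonical_in_B_T[of "\<alpha> \<^bold>\<and> \<beta>"]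
    unfolding canonical_def Conj_mem_iff Box_Conj_iff Neg_Conj_iff mconj.simps mem_Collect_eq prod.case le_bool_def
    by blast
qed

lemma canonical_Disj: "canonical (\<alpha> \<^bold>\<or> \<beta>) \<in> mdisj (canonical \<alpha>) (canonical \<beta>)"
proof -
  \<comment> \<open>Dually, the second coordinate is the loose one, bounded by \<open>N4\<close>
    from below and by \<open>N9\<close> and \<open>N10\<close> from above.\<close>
  have "\<^bold>\<box> \<alpha> \<in> \<Delta> \<or> \<^bold>\<box> \<beta> \<in> \<Delta> \<Longrightarrow> \<^bold>\<box> (\<alpha> \<^bold>\<or> \<beta>) \<in> \<Delta>"
    using axiom_MP[OF N4] Disj_mem_iff by blast
  moreover have "\<^bold>\<box> (\<alpha> \<^bold>\<or> \<beta>) \<in> \<Delta> \<Longrightarrow> \<^bold>\<box> \<^bold>\<sim> \<alpha> \<in> \<Delta> \<Longrightarrow> \<^bold>\<box> \<beta> \<in> \<Delta>"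
    by (rule axiom_MP2[OF N9])
  moreover have "\<^bold>\<box> (\<alpha> \<^bold>\<or> \<beta>) \<in> \<Delta> \<Longrightarrow> \<^bold>\<box> \<^bold>\<sim> \<beta> \<in> \<Delta> \<Longrightarrow> \<^bold>\<box> \<alpha> \<in> \<Delta>"
    by (rule axiom_MP2[OF N10])
  ultimately show ?thesis
    using canonical_in_B_T[of "\<alpha> \<^bold>\<or> \<beta>"]
    unfolding canonical_def Disj_mem_iff Box_Sim_Disj_iff Neg_Disj_iff mdisj.simps mem_Collect_eq prod.case le_bool_def
    by blast
qed

lemma canonical_Impl: "canonical (\<alpha> \<^bold>\<rightarrow> \<beta>) \<in> mimpl (canonical \<alpha>) (canonical \<beta>)"
proof -
  \<comment> \<open>Again the second coordinate is loose: \<open>M1\<close> bounds it from below,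
    \<open>K\<close> and \<open>K1\<close> from above.\<close>
  have "\<^bold>\<box> \<^bold>\<sim> \<alpha> \<in> \<Delta> \<or> \<^bold>\<box> \<beta> \<in> \<Delta> \<Longrightarrow> \<^bold>\<box> (\<alpha> \<^bold>\<rightarrow> \<beta>) \<in> \<Delta>"
    using axiom_MP[OF M1] Disj_mem_iff by blast
  moreover have "\<^bold>\<box> (\<alpha> \<^bold>\<rightarrow> \<beta>) \<in> \<Delta> \<Longrightarrow> \<^bold>\<box> \<alpha> \<in> \<Delta> \<Longrightarrow> \<^bold>\<box> \<beta> \<in> \<Delta>"
    by (rule axiom_MP2[OF K])
  moreover have "\<^bold>\<box> (\<alpha> \<^bold>\<rightarrow> \<beta>) \<in> \<Delta> \<Longrightarrow> \<^bold>\<box> \<^bold>\<sim> \<beta> \<in> \<Delta> \<Longrightarrow> \<^bold>\<box> \<^bold>\<sim> \<alpha> \<in> \<Delta>"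
    by (rule axiom_MP2[OF K1])
  ultimately show ?thesis
    using canonical_in_B_T[of "\<alpha> \<^bold>\<rightarrow> \<beta>"]
    unfolding canonical_def Impl_mem_iff Box_Sim_Impl_iff Neg_Impl_iff mimpl.simps mem_Collect_eq prod.case le_bool_def
    by blast
qed

lemma canonical_Neg: "canonical (\<^bold>\<not> \<alpha>) \<in> mneg (canonical \<alpha>)"
  using axiom_Equiv[OF NegNeg, of \<alpha>]
  by (simp add: canonical_def Box_Neg_iff Box_Sim_Neg_iff)

text \<open>The bounds on the fourth coordinate are the \<open>B_T\<close> conditions linking
  \<open>Box\<close> and \<open>Neg\<close>, taken at \<open>Sim\<close> \<alpha>;
  \<open>DN1\<close> rewrites the lower one in terms of \<open>Box\<close> \<alpha>.\<close>

lemma canonical_Sim: "canonical (\<^bold>\<sim> \<alpha>) \<in> msim (canonical \<alpha>)"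
  using canonical_in_B_T[of "\<^bold>\<sim> \<alpha>"] Box_Sim_imp_Neg_mem[of "\<^bold>\<sim> \<alpha>"] Box_imp_Neg_not_mem[of "\<^bold>\<sim> \<alpha>"]
  by (auto simp: canonical_def Sim_mem_iff Box_Sim_Sim_iff)

lemma canonical_Box: "canonical (\<^bold>\<box> \<alpha>) \<in> mbox (canonical \<alpha>)"
  using canonical_in_B_T[of "\<^bold>\<box> \<alpha>"] by (simp add: canonical_def)

lemma valuation_canonical: "valuation canonical"
  unfolding valuation_def
  using canonical_in_B_T canonical_Conj canonical_Disj canonical_Impl canonical_Neg canonical_Sim
    canonical_Box by blast

lemma canonical_in_D_iff: "canonical \<psi> \<in> D \<longleftrightarrow> \<psi> \<in> \<Delta>"
  using canonical_in_B_T[of \<psi>] by (auto simp: canonical_def D_def)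

lemma not_entails_goal: "\<not> \<Delta> \<Turnstile>\<^sub>I\<^sub>v\<^sub>F\<^sub>D\<^sub>E\<^sub>T \<phi>"
  unfolding entails_def using valuation_canonical canonical_in_D_iff goal_not_mem by blast

end

theorem mainTheorem2:
  fixes \<Gamma> :: "('v::countable) fm set" and \<phi> :: "'v fm"
  assumes "\<Gamma> \<Turnstile>\<^sub>I\<^sub>v\<^sub>F\<^sub>D\<^sub>E\<^sub>T \<phi>"
  shows "\<Gamma> \<turnstile>\<^sub>I\<^sub>v\<^sub>F\<^sub>D\<^sub>E\<^sub>T \<phi>"
proof (rule ccontr)
  assume "\<not> \<Gamma> \<turnstile>\<^sub>I\<^sub>v\<^sub>F\<^sub>D\<^sub>E\<^sub>T \<phi>"
  then obtain \<Delta> where "\<Gamma> \<subseteq> \<Delta>" and "maximal_non_deriving \<phi> \<Delta>"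
    by (rule lindenbaum)
  \<comment> \<open>Entailment is monotone in its premises, so it passes from \<Gamma> to \<Delta>,
    where the canonical valuation refutes it.\<close>
  moreover from assms \<open>\<Gamma> \<subseteq> \<Delta>\<close> have "\<Delta> \<Turnstile>\<^sub>I\<^sub>v\<^sub>F\<^sub>D\<^sub>E\<^sub>T \<phi>"
    unfolding entails_def by blast
  ultimately show False
    using not_entails_goal by blast
qed

end
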